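(* Let $\mathcal{A}$ and $\mathcal{U}$ be Banach algebras such that $\mathcal{U}$ is a Banach $\mathcal{A}$-bimodule with compatible actions and norm, and let $D$ be a derivation on $\mathcal{A}\ltimes\mathcal{U}$ written as $$D((a,x))=(\delta_1(a)+\tau_1(x),\,\delta_2(a)+\tau_2(x))\qquad((a,x)\in\mathcal{A}\ltimes\mathcal{U}).$$ Then: (i) $\mathfrak{S}(\tau_1)$ is an ideal in $\mathcal{A}$. If $\tau_2$ is continuous, then $\mathfrak{S}(\tau_1)\subseteq ann_{\mathcal{A}}\mathcal{U}$; and if $\tau_2(\mathcal{U})\subseteq ann_{\mathcal{U}}\mathcal{U}$, then $\mathfrak{S}(\tau_1)\subseteq(\mathfrak{S}(\tau_2):\mathcal{U})_{\mathcal{A}}$. (ii) $\mathfrak{S}(\tau_2)$ is an $\mathcal{A}$-sub-bimodule of $\mathcal{U}$; and if $\tau_1$ is continuous or $\tau_1(\mathcal{U})\subseteq ann_{\mathcal{A}}\mathcal{U}$, then $\mathfrak{S}(\tau_2)$ is an ideal in $\mathcal{U}$. (iii) $\mathfrak{S}(\delta_1)$ is an ideal in $\mathcal{A}$; and if $\delta_2$ is continuous or $\delta_2(\mathcal{A})\subseteq ann_{\mathcal{U}}\mathcal{U}$, then $\mathfrak{S}(\delta_1)\subseteq(\mathfrak{S}(\tau_2):\mathcal{U})_{\mathcal{A}}$. (iv) $\mathfrak{S}(\delta_2)$ is an $\mathcal{A}$-sub-bimodule of $\mathcal{U}$; and if $\delta_1$ is continuous or $\delta_1(\mathcal{A})\subseteq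 ann_{\mathcal{A}}\mathcal{U}$, then $\mathfrak{S}(\delta_2)\subseteq(\mathfrak{S}(\tau_2):\mathcal{U})_{\mathcal{U}}$.
   Context: All algebras are over $\mathbb{C}$. "Banach $\mathcal{A}$-bimodule with compatible actions and norm" means: $\|ax\|\le\|a\|\|x\|$, $\|xa\|\le\|x\|\|a\|$, and $a(xy)=(ax)y$, $(xy)a=x(ya)$, $(xa)y=x(ay)$ for all $a\in\mathcal{A}$, $x,y\in\mathcal{U}$. The semidirect product $\mathcal{A}\ltimes\mathcal{U}$ is $\mathcal{A}\times\mathcal{U}$ with multiplication $(a,x)(b,y)=(ab,\,ay+xb+xy)$ and norm $\|(a,x)\|=\|a\|+\|x\|$. A derivation on an algebra $\mathcal{B}$ is a linear map $D:\mathcal{B}\to\mathcal{B}$ (not assumed continuous) with $D(bc)=bD(c)+D(b)c$. The linear maps $\delta_1:\mathcal{A}\to\mathcal{A}$, $\delta_2:\mathcal{A}\to\mathcal{U}$, $\tau_1:\mathcal{U}\to\mathcal{A}$, $\tau_2:\mathcal{U}\to\mathcal{U}$ are the components of $D$: $D((a,0))=(\delta_1(a),\delta_2(a))$ and $D((0,x))=(\tau_1(x),\tau_2(x))$. For a linear map $T:\mathcal{X}\to\mathcal{Y}$ of Banach spaces, the separating space is $\mathfrak{S}(T)=\{y\in\mathcal{Y}\mid \exists\,\{x_n\}\subseteq\mathcal{X},\ x_n\to0,\ T(x_n)\to y\}$. Further, $ann_{\mathcal{A}}\mathcal{U}=\{a\in\mathcal{A}\mid a\mathcal{U}=\mathcal{U}a=(0)\}$,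 $ann_{\mathcal{U}}\mathcal{U}=\{x\in\mathcal{U}\mid x\mathcal{U}=\mathcal{U}x=(0)\}$; for a subspace $\mathcal{N}\subseteq\mathcal{U}$, $(\mathcal{N}:\mathcal{U})_{\mathcal{A}}=\{a\in\mathcal{A}\mid a\mathcal{U}\subseteq\mathcal{N},\ \mathcal{U}a\subseteq\mathcal{N}\}$ and $(\mathcal{N}:\mathcal{U})_{\mathcal{U}}=\{x\in\mathcal{U}\mid x\mathcal{U}\subseteq\mathcal{N},\ \mathcal{U}x\subseteq\mathcal{N}\}$. Ideals are two-sided. *)

theory Defs
  imports "HOL-Analysis.Analysis"
begin

text \<open>The distribution only provides real normed algebras, so a complex scalar multiplication
  extending the real one is added. Algebras need not be unital.\<close>

class complex_vector = real_vector +
  fixes scaleC :: "complex \<Rightarrow> 'a \<Rightarrow> 'a"  (infixr "*\<^sub>C" 75)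
  assumes scaleC_add_right: "scaleC c (x + y) = scaleC c x + scaleC c y"
    and scaleC_add_left: "scaleC (c + d) x = scaleC c x + scaleC d x"
    and scaleC_scaleC: "scaleC c (scaleC d x) = scaleC (c * d) x"
    and scaleC_one: "scaleC 1 x = x"
    and scaleR_scaleC: "scaleR r x = scaleC (complex_of_real r) x"

class complex_normed_vector = complex_vector + real_normed_vector +
  assumes norm_scaleC: "norm (scaleC c x) = cmod c * norm x"

class complex_banach_algebra = complex_normed_vector + real_normed_algebra + banach +
  assumes mult_scaleC_left: "scaleC c x * y = scaleC c (x * y)"
    and mult_scaleC_right: "x * scaleC c y = scaleC c (x * y)"

global_interpretation complex_vector: vector_space "scaleC :: complex \<Rightarrow> 'a \<Rightarrow> 'a::complex_vector"
  by unfold_locales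
    (simp_all add: scaleC_add_right scaleC_add_left scaleC_scaleC scaleC_one)

instantiation complex :: complex_banach_algebra
begin
definition scaleC_complex :: "complex \<Rightarrow> complex \<Rightarrow> complex"
  where "scaleC_complex c x = c * x"
instance
  by standard (simp_all add: scaleC_complex_def algebra_simps scaleR_conv_of_real norm_mult)
end

instantiation prod :: (complex_vector, complex_vector) complex_vector
begin
definition scaleC_prod :: "complex \<Rightarrow> 'a \<times> 'b \<Rightarrow> 'a \<times> 'b"
  where "scaleC_prod c p = (c *\<^sub>C fst p, c *\<^sub>C snd p)"
instance
  by standard (auto simp: scaleC_prod_def prod_eq_iff scaleC_add_right scaleC_add_left
      scaleC_scaleC scaleC_one scaleR_scaleC)
end

abbreviation clinear :: "('a::complex_vector \<Rightarrow> 'b::complex_vector) \<Rightarrow> bool"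
  where "clinear \<equiv> Vector_Spaces.linear (*\<^sub>C) (*\<^sub>C)"

abbreviation csubspace :: "'a::complex_vector set \<Rightarrow> bool"
  where "csubspace \<equiv> complex_vector.subspace"

definition algebra_ideal :: "'a::complex_banach_algebra set \<Rightarrow> bool"
  where "algebra_ideal I \<longleftrightarrow> csubspace I \<and> (\<forall>a. \<forall>x\<in>I. a * x \<in> I \<and> x * a \<in> I)"

definition separating_space ::
    "('x::real_normed_vector \<Rightarrow> 'y::real_normed_vector) \<Rightarrow> 'y set"
  where "separating_space T =
    {y. \<exists>x :: nat \<Rightarrow> 'x. x \<longlonglongrightarrow> 0 \<and> (\<lambda>n. T (x n)) \<longlonglongrightarrow> y}"

text \<open>The predicate \<open>derivation m D\<close> refers to the algebra on the type \<open>'b\<close> with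
  multiplication \<open>m\<close>, because the multiplication of a semidirect product depends on the
  module actions and hence cannot be a type class operation. Continuity is not required.\<close>

definition derivation :: "('b \<Rightarrow> 'b \<Rightarrow> 'b) \<Rightarrow> ('b::complex_vector \<Rightarrow> 'b) \<Rightarrow> bool"
  where "derivation m D \<longleftrightarrow> clinear D \<and> (\<forall>b c. D (m b c) = m b (D c) + m (D b) c)"

text \<open>Banach bimodules over \<open>'a\<close> with compatible actions and norm:
  \<open>lact a x\<close> is $ax$ and \<open>ract x a\<close> is $xa$.\<close>

locale compatible_banach_bimodule =
  fixes lact :: "'a::complex_banach_algebra \<Rightarrow> 'u::complex_banach_algebra \<Rightarrow> 'u"
    and ract :: "'u \<Rightarrow> 'a \<Rightarrow> 'u"
  assumes lact_linear_left: "\<And>x. clinear (\<lambda>a. lact a x)"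
    and lact_linear_right: "\<And>a. clinear (\<lambda>x. lact a x)"
    and ract_linear_left: "\<And>a. clinear (\<lambda>x. ract x a)"
    and ract_linear_right: "\<And>x. clinear (\<lambda>a. ract x a)"
    and lact_assoc: "lact (a * b) x = lact a (lact b x)"
    and ract_assoc: "ract x (a * b) = ract (ract x a) b"
    and lact_ract: "ract (lact a x) b = lact a (ract x b)"
    and norm_lact: "norm (lact a x) \<le> norm a * norm x"
    and norm_ract: "norm (ract x a) \<le> norm x * norm a"
    and compat_left: "lact a (x * y) = lact a x * y"
    and compat_right: "ract (x * y) a = x * ract y a"
    and compat_middle: "ract x a * y = x * lact a y"

definition sub_bimodule ::
    "('a \<Rightarrow> 'u \<Rightarrow> 'u) \<Rightarrow> ('u \<Rightarrow> 'a \<Rightarrow> 'u) \<Rightarrow> 'u::complex_vector set \<Rightarrow> bool"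
  where "sub_bimodule lact ract N \<longleftrightarrow>
    csubspace N \<and> (\<forall>a. \<forall>x\<in>N. lact a x \<in> N \<and> ract x a \<in> N)"

definition semidirect_mult ::
    "('a::complex_banach_algebra \<Rightarrow> 'u::complex_banach_algebra \<Rightarrow> 'u) \<Rightarrow> ('u \<Rightarrow> 'a \<Rightarrow> 'u)
      \<Rightarrow> 'a \<times> 'u \<Rightarrow> 'a \<times> 'u \<Rightarrow> 'a \<times> 'u"
  where "semidirect_mult lact ract p q = (case p of (a, x) \<Rightarrow> case q of (b, y) \<Rightarrow>
    (a * b, lact a y + ract x b + x * y))"

text \<open>The library norm on \<open>'a \<times> 'u\<close> is the Euclidean one. The norm of the semidirect
  product is the equivalent sum norm; derivations do not depend on it.\<close>

definition semidirect_norm :: "'a::real_normed_vector \<times> 'u::real_normed_vector \<Rightarrow> real"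
  where "semidirect_norm p = norm (fst p) + norm (snd p)"

lemma semidirect_norm_equivalent:
  "norm p \<le> semidirect_norm p" "semidirect_norm p \<le> 2 * norm p"
proof -
  show "norm p \<le> semidirect_norm p"
    by (simp add: semidirect_norm_def norm_prod_def sqrt_sum_squares_le_sum)
  have "norm (fst p) \<le> norm p" "norm (snd p) \<le> norm p"
    by (simp_all add: norm_prod_def)
  then show "semidirect_norm p \<le> 2 * norm p"
    by (simp add: semidirect_norm_def)
qed

context compatible_banach_bimodule
begin

lemmas action_add =
  Vector_Spaces.linear.axioms(3)[OF lact_linear_left, THEN module_hom.add]
  Vector_Spaces.linear.axioms(3)[OF lact_linear_right, THEN module_hom.add]
  Vector_Spaces.linear.axioms(3)[OF ract_linear_left, THEN module_hom.add]
  Vector_Spaces.linear.axioms(3)[OF ract_linear_right, THEN module_hom.add]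

lemma semidirect_mult_assoc:
  "semidirect_mult lact ract (semidirect_mult lact ract p q) r =
    semidirect_mult lact ract p (semidirect_mult lact ract q r)"
  by (auto simp: semidirect_mult_def action_add lact_assoc ract_assoc lact_ract
      compat_left compat_right compat_middle algebra_simps split: prod.splits)

lemma semidirect_norm_mult:
  "semidirect_norm (semidirect_mult lact ract p q) \<le> semidirect_norm p * semidirect_norm q"
proof -
  obtain a x b y where pq: "p = (a, x)" "q = (b, y)" by (cases p, cases q)
  have "norm (lact a y + ract x b + x * y) \<le> norm a * norm y + norm x * norm b + norm x * norm y"
    by (intro norm_triangle_mono norm_lact norm_ract norm_mult_ineq)
  then show ?thesis
    using norm_mult_ineq[of a b]
    by (simp add: pq semidirect_mult_def semidirect_norm_def algebra_simps)
qed

end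

text \<open>\<open>transporter_alg lact ract N\<close> and \<open>transporter_self N\<close> are the spaces $(N : U)_A$
  and $(N : U)_U$.\<close>

definition ann_alg ::
    "('a::complex_banach_algebra \<Rightarrow> 'u::complex_banach_algebra \<Rightarrow> 'u) \<Rightarrow> ('u \<Rightarrow> 'a \<Rightarrow> 'u) \<Rightarrow> 'a set"
  where "ann_alg lact ract =
    {a. \<forall>x. lact a x = 0 \<and> ract x a = 0}"

definition ann_self :: "'u::complex_banach_algebra set"
  where "ann_self = {x. \<forall>y. x * y = 0 \<and> y * x = 0}"

definition transporter_alg ::
    "('a \<Rightarrow> 'u \<Rightarrow> 'u) \<Rightarrow> ('u \<Rightarrow> 'a \<Rightarrow> 'u) \<Rightarrow> 'u::complex_banach_algebra set
      \<Rightarrow> 'a::complex_banach_algebra set"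
  where "transporter_alg lact ract N = {a. \<forall>x. lact a x \<in> N \<and> ract x a \<in> N}"

definition transporter_self :: "'u::complex_banach_algebra set \<Rightarrow> 'u set"
  where "transporter_self N = {x. \<forall>y. x * y \<in> N \<and> y * x \<in> N}"

end

theory Submission
  imports Defs
begin

text \<open>Write \<open>S(T)\<close> for the separating space. Everything rests on one principle: if \<open>f\<close> and \<open>g\<close>
  are bounded linear and \<open>T' (f x) - g (T x) \<rightarrow> 0\<close> as \<open>x \<rightarrow> 0\<close>, then \<open>g\<close> maps \<open>S(T)\<close> into
  \<open>S(T')\<close>, because \<open>f\<close> sends a null sequence witnessing \<open>y \<in> S(T)\<close> to one witnessing
  \<open>g y \<in> S(T')\<close> (lemma \<open>separating_space_image\<close>).

  Comparing components in the Leibniz rule for the products of \<open>(a, 0)\<close> and \<open>(0, x)\<close> gives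
  identities such as
  \<open>\<tau>\<^sub>2 (a x) = a \<tau>\<^sub>2(x) + \<delta>\<^sub>1(a) x + \<delta>\<^sub>2(a) x\<close> and
  \<open>\<tau>\<^sub>2 (x y) = x \<tau>\<^sub>1(y) + x \<tau>\<^sub>2(y) + \<tau>\<^sub>1(x) y + \<tau>\<^sub>2(x) y\<close>.
  Read as functions of one factor with the other one fixed, each of them expresses
  \<open>T'\<close> of a product through one term \<open>g (T z)\<close> and further terms, with \<open>z\<close> the varying factor. The terms in which
  \<open>z\<close> itself is acted on by a fixed element are small with \<open>z\<close>. The only other term that can occur is
  \<open>h (T'' z)\<close> with \<open>h\<close> a multiplication or action by a fixed element, and it tends to zero when
  \<open>T''\<close> is continuous or takes values in the annihilator (lemma \<open>tendsto_zero_if_cont_or_annihilating\<close>);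
  in the statements without such a hypothesis it does not occur.
  The ideal, sub-bimodule and transporter properties are all instances of the principle. The
  inclusion in the annihilator follows from the one in a transporter, since a continuous linear map
  has separating space \<open>{0}\<close>.\<close>

section \<open>Separating spaces of linear maps\<close>

lemma clinear_add: "clinear f \<Longrightarrow> f (x + y) = f x + f y"
  by (rule module_hom.add[OF Vector_Spaces.linear.axioms(3)])

lemma clinear_scaleC: "clinear f \<Longrightarrow> f (c *\<^sub>C x) = c *\<^sub>C f x"
  by (rule module_hom.scale[OF Vector_Spaces.linear.axioms(3)])

lemma clinear_zero: "clinear f \<Longrightarrow> f 0 = 0"
  by (rule module_hom.zero[OF Vector_Spaces.linear.axioms(3)])

lemma bounded_linear_if_clinear:
  fixes f :: "'x::complex_normed_vector \<Rightarrow> 'y::complex_normed_vector"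
  assumes "clinear f" and "\<And>x. norm (f x) \<le> norm x * K"
  shows "bounded_linear f"
  using assms
  by (intro bounded_linear_intro[where K = K]) (simp_all add: clinear_add scaleR_scaleC clinear_scaleC)

lemma bounded_linear_scaleC:
  "bounded_linear (\<lambda>x::'x::complex_normed_vector. c *\<^sub>C x)"
  by (rule bounded_linear_intro[where K = "cmod c"])
    (simp_all add: scaleC_add_right scaleR_scaleC scaleC_scaleC mult.commute norm_scaleC)

text \<open>The limits at \<open>0\<close> below are taken along \<open>nhds 0\<close> and not \<open>at 0\<close>, because a null sequence may
  take the value \<open>0\<close>.\<close>

lemma bounded_linear_tendsto_zero:
  assumes "bounded_linear f"
  shows "(f \<longlongrightarrow> 0) (nhds 0)"
  using bounded_linear.tendsto_zero[OF assms, of "\<lambda>x. x"] by (simp add: filterlim_ident)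

lemma separating_space_image:
  assumes f: "bounded_linear f" and g: "bounded_linear g"
    and remainder: "((\<lambda>x. T' (f x) - g (T x)) \<longlongrightarrow> 0) (nhds 0)"
    and y: "y \<in> separating_space T"
  shows "g y \<in> separating_space T'"
proof -
  obtain x where x: "x \<longlonglongrightarrow> 0" and Tx: "(\<lambda>n. T (x n)) \<longlonglongrightarrow> y"
    using y by (auto simp: separating_space_def)
  have fx: "(\<lambda>n. f (x n)) \<longlonglongrightarrow> 0"
    using bounded_linear.tendsto_zero[OF f x] .
  have "(\<lambda>n. T' (f (x n)) - g (T (x n))) \<longlonglongrightarrow> 0"
    using filterlim_compose[OF remainder x] .
  from tendsto_add[OF this bounded_linear.tendsto[OF g Tx]]
  have "(\<lambda>n. T' (f (x n))) \<longlonglongrightarrow> g y"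
    by simp
  with fx show ?thesis
    by (auto simp: separating_space_def)
qed

lemma csubspace_separating_space:
  fixes T :: "'x::complex_normed_vector \<Rightarrow> 'y::complex_normed_vector"
  assumes T: "clinear T"
  shows "csubspace (separating_space T)"
proof (rule complex_vector.subspaceI)
  show "0 \<in> separating_space T"
    unfolding separating_space_def
    by (intro CollectI exI[of _ "\<lambda>_. 0"]) (simp add: clinear_zero[OF T])
next
  fix y z assume "y \<in> separating_space T" "z \<in> separating_space T"
  then obtain u v where "u \<longlonglongrightarrow> 0" "(\<lambda>n. T (u n)) \<longlonglongrightarrow> y"
    and "v \<longlonglongrightarrow> 0" "(\<lambda>n. T (v n)) \<longlonglongrightarrow> z"
    by (auto simp: separating_space_def)
  then show "y + z \<in> separating_space T"
    unfolding separating_space_def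
    by (intro CollectI exI[of _ "\<lambda>n. u n + v n"])
      (auto simp: clinear_add[OF T] intro: tendsto_add tendsto_add_zero)
next
  fix c y assume "y \<in> separating_space T"
  then show "c *\<^sub>C y \<in> separating_space T"
    by (rule separating_space_image[OF bounded_linear_scaleC bounded_linear_scaleC, of _ c, rotated])
      (simp add: clinear_scaleC[OF T])
qed

lemma tendsto_zero_if_continuous:
  assumes "continuous_on UNIV T" and "clinear T"
  shows "(T \<longlongrightarrow> 0) (nhds 0)"
  using continuous_on_tendsto_compose[OF assms(1) filterlim_ident, of 0] clinear_zero[OF assms(2)]
  by simp

lemma separating_space_continuous:
  assumes "continuous_on UNIV T" and "clinear T"
  shows "separating_space T \<subseteq> {0}"
proof
  fix y assume "y \<in> separating_space T"
  then obtain x where x: "x \<longlonglongrightarrow> 0" and y: "(\<lambda>n. T (x n)) \<longlonglongrightarrow> y"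
    by (auto simp: separating_space_def)
  have "(\<lambda>n. T (x n)) \<longlonglongrightarrow> 0"
    using filterlim_compose[OF tendsto_zero_if_continuous[OF assms] x] .
  then show "y \<in> {0}"
    using y LIMSEQ_unique by blast
qed

lemma tendsto_zero_if_cont_or_annihilating:
  assumes "clinear T" and h: "bounded_linear h"
    and "continuous_on UNIV T \<or> (\<forall>x. h (T x) = 0)"
  shows "((\<lambda>x. h (T x)) \<longlongrightarrow> 0) (nhds 0)"
  using assms(3)
proof
  assume "continuous_on UNIV T"
  then show ?thesis
    by (intro bounded_linear.tendsto_zero[OF h] tendsto_zero_if_continuous assms(1))
qed simp

section \<open>Components of a derivation on a semidirect product\<close>

context compatible_banach_bimodule
begin

lemma bounded_linear_lact_left: "bounded_linear (\<lambda>a. lact a x)"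
  by (rule bounded_linear_if_clinear[OF lact_linear_left norm_lact])

lemma bounded_linear_lact_right: "bounded_linear (\<lambda>x. lact a x)"
  by (rule bounded_linear_if_clinear[OF lact_linear_right, where K = "norm a"])
    (simp add: norm_lact mult.commute[of "norm _" "norm a"])

lemma bounded_linear_ract_left: "bounded_linear (\<lambda>x. ract x a)"
  by (rule bounded_linear_if_clinear[OF ract_linear_left norm_ract])

lemma bounded_linear_ract_right: "bounded_linear (\<lambda>a. ract x a)"
  by (rule bounded_linear_if_clinear[OF ract_linear_right, where K = "norm x"])
    (simp add: norm_ract mult.commute[of "norm _" "norm x"])

lemmas action_bounded_linear =
  bounded_linear_lact_left bounded_linear_lact_right
  bounded_linear_ract_left bounded_linear_ract_right
  bounded_linear_mult_left bounded_linear_mult_right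

lemmas action_zero =
  lact_linear_left[THEN clinear_zero] lact_linear_right[THEN clinear_zero]
  ract_linear_left[THEN clinear_zero] ract_linear_right[THEN clinear_zero]

end

locale semidirect_derivation = compatible_banach_bimodule lact ract
  for lact :: "'a::complex_banach_algebra \<Rightarrow> 'u::complex_banach_algebra \<Rightarrow> 'u"
    and ract :: "'u \<Rightarrow> 'a \<Rightarrow> 'u" +
  fixes \<delta>\<^sub>1 :: "'a \<Rightarrow> 'a" and \<delta>\<^sub>2 :: "'a \<Rightarrow> 'u" and \<tau>\<^sub>1 :: "'u \<Rightarrow> 'a" and \<tau>\<^sub>2 :: "'u \<Rightarrow> 'u"
  assumes derivation_components: "derivation (semidirect_mult lact ract)
      (\<lambda>(a, x). (\<delta>\<^sub>1 a + \<tau>\<^sub>1 x, \<delta>\<^sub>2 a + \<tau>\<^sub>2 x))"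
    and clinear_components: "clinear \<delta>\<^sub>1" "clinear \<delta>\<^sub>2" "clinear \<tau>\<^sub>1" "clinear \<tau>\<^sub>2"
begin

lemmas component_zero = clinear_components[THEN clinear_zero]

lemma leibniz:
  "(\<delta>\<^sub>1 (a * b) + \<tau>\<^sub>1 (lact a y + ract x b + x * y), \<delta>\<^sub>2 (a * b) + \<tau>\<^sub>2 (lact a y + ract x b + x * y)) =
    semidirect_mult lact ract (a, x) (\<delta>\<^sub>1 b + \<tau>\<^sub>1 y, \<delta>\<^sub>2 b + \<tau>\<^sub>2 y) +
    semidirect_mult lact ract (\<delta>\<^sub>1 a + \<tau>\<^sub>1 x, \<delta>\<^sub>2 a + \<tau>\<^sub>2 x) (b, y)"
  using derivation_components[unfolded derivation_def, THEN conjunct2, rule_format, of "(a, x)" "(b, y)"]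
  by (simp add: semidirect_mult_def)

lemma \<delta>_mult:
  "\<delta>\<^sub>1 (a * b) = a * \<delta>\<^sub>1 b + \<delta>\<^sub>1 a * b"
  "\<delta>\<^sub>2 (a * b) = lact a (\<delta>\<^sub>2 b) + ract (\<delta>\<^sub>2 a) b"
  using leibniz[of a b 0 0] by (simp_all add: semidirect_mult_def component_zero action_zero)

lemma \<tau>_lact:
  "\<tau>\<^sub>1 (lact a x) = a * \<tau>\<^sub>1 x"
  "\<tau>\<^sub>2 (lact a x) = lact a (\<tau>\<^sub>2 x) + lact (\<delta>\<^sub>1 a) x + \<delta>\<^sub>2 a * x"
  using leibniz[of a 0 x 0] by (simp_all add: semidirect_mult_def component_zero action_zero)

lemma \<tau>_ract:
  "\<tau>\<^sub>1 (ract x a) = \<tau>\<^sub>1 x * a"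
  "\<tau>\<^sub>2 (ract x a) = ract x (\<delta>\<^sub>1 a) + x * \<delta>\<^sub>2 a + ract (\<tau>\<^sub>2 x) a"
  using leibniz[of 0 a 0 x] by (simp_all add: semidirect_mult_def component_zero action_zero)

lemma \<tau>\<^sub>2_mult:
  "\<tau>\<^sub>2 (x * y) = ract x (\<tau>\<^sub>1 y) + x * \<tau>\<^sub>2 y + lact (\<tau>\<^sub>1 x) y + \<tau>\<^sub>2 x * y"
  using leibniz[of 0 0 y x] by (simp add: semidirect_mult_def component_zero action_zero)

section \<open>Separating spaces of the components\<close>

lemma algebra_ideal_\<tau>\<^sub>1: "algebra_ideal (separating_space \<tau>\<^sub>1)"
  unfolding algebra_ideal_def
proof (intro conjI allI ballI)
  show "csubspace (separating_space \<tau>\<^sub>1)"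
    by (rule csubspace_separating_space[OF clinear_components(3)])
  fix a b assume b: "b \<in> separating_space \<tau>\<^sub>1"
  show "a * b \<in> separating_space \<tau>\<^sub>1"
    by (rule separating_space_image[OF bounded_linear_lact_right bounded_linear_mult_right _ b, of _ a])
      (simp add: \<tau>_lact)
  show "b * a \<in> separating_space \<tau>\<^sub>1"
    by (rule separating_space_image[OF bounded_linear_ract_left bounded_linear_mult_left _ b, of _ a])
      (simp add: \<tau>_ract)
qed

lemma algebra_ideal_\<delta>\<^sub>1: "algebra_ideal (separating_space \<delta>\<^sub>1)"
  unfolding algebra_ideal_def
proof (intro conjI allI ballI)
  show "csubspace (separating_space \<delta>\<^sub>1)"
    by (rule csubspace_separating_space[OF clinear_components(1)])
  fix a b assume b: "b \<in> separating_space \<delta>\<^sub>1"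
  show "a * b \<in> separating_space \<delta>\<^sub>1"
    by (rule separating_space_image[OF bounded_linear_mult_right bounded_linear_mult_right _ b, of _ a])
      (simp add: \<delta>_mult bounded_linear_tendsto_zero action_bounded_linear)
  show "b * a \<in> separating_space \<delta>\<^sub>1"
    by (rule separating_space_image[OF bounded_linear_mult_left bounded_linear_mult_left _ b, of _ a])
      (simp add: \<delta>_mult bounded_linear_tendsto_zero action_bounded_linear)
qed

lemma sub_bimodule_\<delta>\<^sub>2: "sub_bimodule lact ract (separating_space \<delta>\<^sub>2)"
  unfolding sub_bimodule_def
proof (intro conjI allI ballI)
  show "csubspace (separating_space \<delta>\<^sub>2)"
    by (rule csubspace_separating_space[OF clinear_components(2)])
  fix a x assume x: "x \<in> separating_space \<delta>\<^sub>2"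
  show "lact a x \<in> separating_space \<delta>\<^sub>2"
    by (rule separating_space_image[OF bounded_linear_mult_right bounded_linear_lact_right _ x, of _ a])
      (simp add: \<delta>_mult bounded_linear_tendsto_zero action_bounded_linear)
  show "ract x a \<in> separating_space \<delta>\<^sub>2"
    by (rule separating_space_image[OF bounded_linear_mult_left bounded_linear_ract_left _ x, of _ a])
      (simp add: \<delta>_mult bounded_linear_tendsto_zero action_bounded_linear)
qed

lemma sub_bimodule_\<tau>\<^sub>2: "sub_bimodule lact ract (separating_space \<tau>\<^sub>2)"
  unfolding sub_bimodule_def
proof (intro conjI allI ballI)
  show "csubspace (separating_space \<tau>\<^sub>2)"
    by (rule csubspace_separating_space[OF clinear_components(4)])
  fix a x assume x: "x \<in> separating_space \<tau>\<^sub>2"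
  show "lact a x \<in> separating_space \<tau>\<^sub>2"
    by (rule separating_space_image[OF bounded_linear_lact_right bounded_linear_lact_right _ x, of _ a])
      (simp add: \<tau>_lact tendsto_add_zero bounded_linear_tendsto_zero action_bounded_linear)
  show "ract x a \<in> separating_space \<tau>\<^sub>2"
    by (rule separating_space_image[OF bounded_linear_ract_left bounded_linear_ract_left _ x, of _ a])
      (simp add: \<tau>_ract tendsto_add_zero bounded_linear_tendsto_zero action_bounded_linear)
qed

text \<open>In \<open>\<tau>\<^sub>2 (x y)\<close> the terms \<open>\<tau>\<^sub>1(x) y\<close> and \<open>\<tau>\<^sub>2(x) y\<close> compete: controlling the second makes
  \<open>S(\<tau>\<^sub>1)\<close> act into \<open>S(\<tau>\<^sub>2)\<close>, and controlling the first makes \<open>S(\<tau>\<^sub>2)\<close> an ideal.\<close>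

lemma separating_space_\<tau>\<^sub>1_transporter:
  assumes "continuous_on UNIV \<tau>\<^sub>2 \<or> range \<tau>\<^sub>2 \<subseteq> ann_self"
  shows "separating_space \<tau>\<^sub>1 \<subseteq> transporter_alg lact ract (separating_space \<tau>\<^sub>2)"
  unfolding transporter_alg_def
proof (intro subsetI CollectI allI conjI)
  fix a x assume a: "a \<in> separating_space \<tau>\<^sub>1"
  have cont: "continuous_on UNIV \<tau>\<^sub>2 \<or> (\<forall>z. \<tau>\<^sub>2 z * x = 0)"
    "continuous_on UNIV \<tau>\<^sub>2 \<or> (\<forall>z. x * \<tau>\<^sub>2 z = 0)"
    using assms by (auto simp: ann_self_def)
  note small = cont[THEN tendsto_zero_if_cont_or_annihilating[OF clinear_components(4), rotated]]
  show "lact a x \<in> separating_space \<tau>\<^sub>2"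
    by (rule separating_space_image[OF bounded_linear_mult_left bounded_linear_lact_left _ a, of _ x])
      (simp add: \<tau>\<^sub>2_mult algebra_simps tendsto_add_zero bounded_linear_tendsto_zero
        action_bounded_linear small)
  show "ract x a \<in> separating_space \<tau>\<^sub>2"
    by (rule separating_space_image[OF bounded_linear_mult_right bounded_linear_ract_right _ a, of _ x])
      (simp add: \<tau>\<^sub>2_mult algebra_simps tendsto_add_zero bounded_linear_tendsto_zero
        action_bounded_linear small)
qed

lemma separating_space_\<tau>\<^sub>1_annihilator:
  assumes "continuous_on UNIV \<tau>\<^sub>2"
  shows "separating_space \<tau>\<^sub>1 \<subseteq> ann_alg lact ract"
  using separating_space_\<tau>\<^sub>1_transporter separating_space_continuous[OF assms clinear_components(4)]
    assms
  by (fastforce simp: transporter_alg_def ann_alg_def)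

lemma algebra_ideal_\<tau>\<^sub>2:
  assumes "continuous_on UNIV \<tau>\<^sub>1 \<or> range \<tau>\<^sub>1 \<subseteq> ann_alg lact ract"
  shows "algebra_ideal (separating_space \<tau>\<^sub>2)"
  unfolding algebra_ideal_def
proof (intro conjI allI ballI)
  show "csubspace (separating_space \<tau>\<^sub>2)"
    by (rule csubspace_separating_space[OF clinear_components(4)])
  fix x y assume y: "y \<in> separating_space \<tau>\<^sub>2"
  have cont: "continuous_on UNIV \<tau>\<^sub>1 \<or> (\<forall>z. lact (\<tau>\<^sub>1 z) x = 0)"
    "continuous_on UNIV \<tau>\<^sub>1 \<or> (\<forall>z. ract x (\<tau>\<^sub>1 z) = 0)"
    using assms by (auto simp: ann_alg_def)
  note small = cont[THEN tendsto_zero_if_cont_or_annihilating[OF clinear_components(3), rotated]]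
  show "x * y \<in> separating_space \<tau>\<^sub>2"
    by (rule separating_space_image[OF bounded_linear_mult_right bounded_linear_mult_right _ y, of _ x])
      (simp add: \<tau>\<^sub>2_mult algebra_simps tendsto_add_zero bounded_linear_tendsto_zero
        action_bounded_linear small)
  show "y * x \<in> separating_space \<tau>\<^sub>2"
    by (rule separating_space_image[OF bounded_linear_mult_left bounded_linear_mult_left _ y, of _ x])
      (simp add: \<tau>\<^sub>2_mult algebra_simps tendsto_add_zero bounded_linear_tendsto_zero
        action_bounded_linear small)
qed

text \<open>The same competition takes place between \<open>\<delta>\<^sub>1(a) x\<close> and \<open>\<delta>\<^sub>2(a) x\<close> in \<open>\<tau>\<^sub>2 (a x)\<close>, now read as
  a function of \<open>a\<close>.\<close>

lemma separating_space_\<delta>\<^sub>1_transporter: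
  assumes "continuous_on UNIV \<delta>\<^sub>2 \<or> range \<delta>\<^sub>2 \<subseteq> ann_self"
  shows "separating_space \<delta>\<^sub>1 \<subseteq> transporter_alg lact ract (separating_space \<tau>\<^sub>2)"
  unfolding transporter_alg_def
proof (intro subsetI CollectI allI conjI)
  fix a x assume a: "a \<in> separating_space \<delta>\<^sub>1"
  have cont: "continuous_on UNIV \<delta>\<^sub>2 \<or> (\<forall>b. \<delta>\<^sub>2 b * x = 0)"
    "continuous_on UNIV \<delta>\<^sub>2 \<or> (\<forall>b. x * \<delta>\<^sub>2 b = 0)"
    using assms by (auto simp: ann_self_def)
  note small = cont[THEN tendsto_zero_if_cont_or_annihilating[OF clinear_components(2), rotated]]
  show "lact a x \<in> separating_space \<tau>\<^sub>2"
    by (rule separating_space_image[OF bounded_linear_lact_left bounded_linear_lact_left _ a, of _ x])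
      (simp add: \<tau>_lact algebra_simps tendsto_add_zero bounded_linear_tendsto_zero
        action_bounded_linear small)
  show "ract x a \<in> separating_space \<tau>\<^sub>2"
    by (rule separating_space_image[OF bounded_linear_ract_right bounded_linear_ract_right _ a, of _ x])
      (simp add: \<tau>_ract algebra_simps tendsto_add_zero bounded_linear_tendsto_zero
        action_bounded_linear small)
qed

lemma separating_space_\<delta>\<^sub>2_transporter:
  assumes "continuous_on UNIV \<delta>\<^sub>1 \<or> range \<delta>\<^sub>1 \<subseteq> ann_alg lact ract"
  shows "separating_space \<delta>\<^sub>2 \<subseteq> transporter_self (separating_space \<tau>\<^sub>2)"
  unfolding transporter_self_def
proof (intro subsetI CollectI allI conjI)
  fix x y assume x: "x \<in> separating_space \<delta>\<^sub>2"
  have cont: "continuous_on UNIV \<delta>\<^sub>1 \<or> (\<forall>b. lact (\<delta>\<^sub>1 b) y = 0)"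
    "continuous_on UNIV \<delta>\<^sub>1 \<or> (\<forall>b. ract y (\<delta>\<^sub>1 b) = 0)"
    using assms by (auto simp: ann_alg_def)
  note small = cont[THEN tendsto_zero_if_cont_or_annihilating[OF clinear_components(1), rotated]]
  show "x * y \<in> separating_space \<tau>\<^sub>2"
    by (rule separating_space_image[OF bounded_linear_lact_left bounded_linear_mult_left _ x, of _ y])
      (simp add: \<tau>_lact algebra_simps tendsto_add_zero bounded_linear_tendsto_zero
        action_bounded_linear small)
  show "y * x \<in> separating_space \<tau>\<^sub>2"
    by (rule separating_space_image[OF bounded_linear_ract_right bounded_linear_mult_right _ x, of _ y])
      (simp add: \<tau>_ract algebra_simps tendsto_add_zero bounded_linear_tendsto_zero
        action_bounded_linear small)
qed

end

theorem theorem3p5: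
  fixes lact :: "'a::complex_banach_algebra \<Rightarrow> 'u::complex_banach_algebra \<Rightarrow> 'u"
    and ract :: "'u \<Rightarrow> 'a \<Rightarrow> 'u"
    and D :: "'a \<times> 'u \<Rightarrow> 'a \<times> 'u"
    and \<delta>\<^sub>1 :: "'a \<Rightarrow> 'a" and \<delta>\<^sub>2 :: "'a \<Rightarrow> 'u"
    and \<tau>\<^sub>1 :: "'u \<Rightarrow> 'a" and \<tau>\<^sub>2 :: "'u \<Rightarrow> 'u"
  assumes "compatible_banach_bimodule lact ract"
    and "derivation (semidirect_mult lact ract) D"
    and "clinear \<delta>\<^sub>1" and "clinear \<delta>\<^sub>2" and "clinear \<tau>\<^sub>1" and "clinear \<tau>\<^sub>2"
    and "\<And>a x. D (a, x) = (\<delta>\<^sub>1 a + \<tau>\<^sub>1 x, \<delta>\<^sub>2 a + \<tau>\<^sub>2 x)"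
  shows
    "(algebra_ideal (separating_space \<tau>\<^sub>1) \<and>
      (continuous_on UNIV \<tau>\<^sub>2 \<longrightarrow> separating_space \<tau>\<^sub>1 \<subseteq> ann_alg lact ract) \<and>
      (range \<tau>\<^sub>2 \<subseteq> ann_self \<longrightarrow>
        separating_space \<tau>\<^sub>1 \<subseteq> transporter_alg lact ract (separating_space \<tau>\<^sub>2))) \<and>
     (sub_bimodule lact ract (separating_space \<tau>\<^sub>2) \<and>
      (continuous_on UNIV \<tau>\<^sub>1 \<or> range \<tau>\<^sub>1 \<subseteq> ann_alg lact ract \<longrightarrow>
        algebra_ideal (separating_space \<tau>\<^sub>2))) \<and>
     (algebra_ideal (separating_space \<delta>\<^sub>1) \<and>
      (continuous_on UNIV \<delta>\<^sub>2 \<or> range \<delta>\<^sub>2 \<subseteq> ann_self \<longrightarrow>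
        separating_space \<delta>\<^sub>1 \<subseteq> transporter_alg lact ract (separating_space \<tau>\<^sub>2))) \<and>
     (sub_bimodule lact ract (separating_space \<delta>\<^sub>2) \<and>
      (continuous_on UNIV \<delta>\<^sub>1 \<or> range \<delta>\<^sub>1 \<subseteq> ann_alg lact ract \<longrightarrow>
        separating_space \<delta>\<^sub>2 \<subseteq> transporter_self (separating_space \<tau>\<^sub>2)))"
proof -
  have "D = (\<lambda>(a, x). (\<delta>\<^sub>1 a + \<tau>\<^sub>1 x, \<delta>\<^sub>2 a + \<tau>\<^sub>2 x))"
    using assms(7) by auto
  then interpret semidirect_derivation lact ract \<delta>\<^sub>1 \<delta>\<^sub>2 \<tau>\<^sub>1 \<tau>\<^sub>2
    using assms(1-6) by (auto intro!: semidirect_derivation.intro semidirect_derivation_axioms.intro)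
  show ?thesis
    using algebra_ideal_\<tau>\<^sub>1 algebra_ideal_\<delta>\<^sub>1 sub_bimodule_\<tau>\<^sub>2 sub_bimodule_\<delta>\<^sub>2
      algebra_ideal_\<tau>\<^sub>2 separating_space_\<tau>\<^sub>1_annihilator separating_space_\<tau>\<^sub>1_transporter
      separating_space_\<delta>\<^sub>1_transporter separating_space_\<delta>\<^sub>2_transporter
    by blast
qed

end
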